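(* Vague convergence and loose convergence are not metrizable on the space of all finite signed Borel measures on $\mathbb{R}$. That is, there is no metric $d$ on this space such that for all finite signed measures $\mu_n,\mu$ ($n\in\mathbb{N}$), $d(\mu_n,\mu)\to0$ if and only if $\mu_n$ converges vaguely to $\mu$; and there is no metric $d$ on this space such that for all finite signed measures $\mu_n,\mu$ ($n\in\mathbb{N}$), $d(\mu_n,\mu)\to0$ if and only if $\mu_n$ converges loosely to $\mu$.
   Context: For finite signed Borel measures on $\mathbb{R}$, $\mu_n$ converges vaguely to $\mu$ if $\int f\,d\mu_n\to\int f\,d\mu$ for all continuous $f:\mathbb{R}\to\mathbb{R}$ with compact support; $\mu_n$ converges loosely to $\mu$ if $\int f\,d\mu_n\to\int f\,d\mu$ for all continuous $f:\mathbb{R}\to\mathbb{R}$ vanishing at infinity. *)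

theory Defs
  imports "HOL-Analysis.Analysis"
begin

text \<open>
  Real-valued signed measures on a measurable space. Sets outside the sigma-algebra are sent to
  the dummy value 0, so that two signed measures are equal as functions if and only if they agree
  on all measurable sets. Without this, separation of points would fail for every
  candidate metric.
\<close>

definition finite_signed_measures :: "'a measure \<Rightarrow> ('a set \<Rightarrow> real) set" where
  "finite_signed_measures M =
    {\<mu>. (\<forall>A. range A \<subseteq> sets M \<longrightarrow> disjoint_family A \<longrightarrow> (\<lambda>n::nat. \<mu> (A n)) sums \<mu> (\<Union>n. A n)) \<and>
        (\<forall>A. A \<notin> sets M \<longrightarrow> \<mu> A = 0)}"

text \<open>
  The Jordan decomposition, given by the upper variation
  \<open>\<mu>\<^sup>+ A = sup {\<mu> B | B \<subseteq> A measurable}\<close> and the lower variation \<open>\<mu>\<^sup>- = (- \<mu>)\<^sup>+\<close>.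
  The function \<open>ennreal\<close> sends negative reals to 0, which does not change the supremum because
  \<open>B = {}\<close> contributes the value 0. For a finite signed measure this set function is countably
  additive and finite, so \<open>measure_of\<close> yields a genuine finite measure.
\<close>

definition positive_variation :: "'a measure \<Rightarrow> ('a set \<Rightarrow> real) \<Rightarrow> 'a measure" where
  "positive_variation M \<mu> =
    measure_of (space M) (sets M) (\<lambda>A. SUP B\<in>{B \<in> sets M. B \<subseteq> A}. ennreal (\<mu> B))"

definition negative_variation :: "'a measure \<Rightarrow> ('a set \<Rightarrow> real) \<Rightarrow> 'a measure" where
  "negative_variation M \<mu> = positive_variation M (\<lambda>A. - \<mu> A)"

definition signed_integral :: "'a measure \<Rightarrow> ('a set \<Rightarrow> real) \<Rightarrow> ('a \<Rightarrow> real) \<Rightarrow> real" where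
  "signed_integral M \<mu> f =
    integral\<^sup>L (positive_variation M \<mu>) f - integral\<^sup>L (negative_variation M \<mu>) f"

definition vaguely_converges :: "(nat \<Rightarrow> real set \<Rightarrow> real) \<Rightarrow> (real set \<Rightarrow> real) \<Rightarrow> bool" where
  "vaguely_converges \<mu>s \<mu> \<longleftrightarrow>
    (\<forall>f :: real \<Rightarrow> real. continuous_on UNIV f \<longrightarrow> compact (closure {x. f x \<noteq> 0}) \<longrightarrow>
      (\<lambda>n. signed_integral borel (\<mu>s n) f) \<longlonglongrightarrow> signed_integral borel \<mu> f)"

definition loosely_converges :: "(nat \<Rightarrow> real set \<Rightarrow> real) \<Rightarrow> (real set \<Rightarrow> real) \<Rightarrow> bool" where
  "loosely_converges \<mu>s \<mu> \<longleftrightarrow>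
    (\<forall>f :: real \<Rightarrow> real. continuous_on UNIV f \<longrightarrow> (f \<longlongrightarrow> 0) at_infinity \<longrightarrow>
      (\<lambda>n. signed_integral borel (\<mu>s n) f) \<longlonglongrightarrow> signed_integral borel \<mu> f)"

text \<open>
  The locale \<^locale>\<open>Metric_space\<close> asks for nonnegativity and symmetry also outside the carrier.
  This is no restriction: a metric given on the carrier can be extended by 0.
\<close>

definition metrizes_convergence ::
  "'b set \<Rightarrow> ((nat \<Rightarrow> 'b) \<Rightarrow> 'b \<Rightarrow> bool) \<Rightarrow> ('b \<Rightarrow> 'b \<Rightarrow> real) \<Rightarrow> bool" where
  "metrizes_convergence S conv d \<longleftrightarrow>
    Metric_space S d \<and>
    (\<forall>\<mu>s \<mu>. range \<mu>s \<subseteq> S \<longrightarrow> \<mu> \<in> S \<longrightarrow> ((\<lambda>n. d (\<mu>s n) \<mu>) \<longlonglongrightarrow> 0 \<longleftrightarrow> conv \<mu>s \<mu>))"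

end

theory Submission imports Defs "HOL-Probability.Giry_Monad" begin

text \<open>
  For a fixed weight \<open>c\<close>, the dipoles \<open>c (\<delta>\<^sub>x - \<delta>\<^sub>0)\<close> converge to \<open>0\<close> as \<open>x \<rightarrow> 0\<close>. A metric for
  the convergence would allow a diagonal choice: points \<open>x\<^sub>k \<noteq> 0\<close> such that the dipoles
  \<open>2\<^sup>k (\<delta>\<^sub>y - \<delta>\<^sub>0)\<close> with \<open>y = x\<^sub>k\<close> still converge to \<open>0\<close> as \<open>k \<rightarrow> \<infinity>\<close>. However, once the \<open>x\<^sub>k\<close> are
  given, the continuous function \<open>\<Sum>\<^sub>j 2\<^bsup>-j\<^esup> min 1 (\<bar>x\<bar> / \<bar>x\<^sub>j\<bar>)\<close>, cut off to compact support,
  vanishes at \<open>0\<close> and is at least \<open>2\<^bsup>-k\<^esup>\<close> at \<open>x\<^sub>k\<close>.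
\<close>

text \<open>The value 0 on non-Borel sets is what membership in
  \<open>finite_signed_measures\<close> demands.\<close>

definition dipole :: "real \<Rightarrow> 'a::topological_space \<Rightarrow> 'a \<Rightarrow> 'a set \<Rightarrow> real" where
  "dipole c a b A = (if A \<in> sets borel then c * (indicator A a - indicator A b) else 0)"

lemma dipole_finite_signed: "dipole c a b \<in> finite_signed_measures borel"
proof -
  have "(\<lambda>n::nat. dipole c a b (A n)) sums dipole c a b (\<Union>n. A n)"
    if A: "range A \<subseteq> sets borel" and d: "disjoint_family A" for A
  proof -
    have "(\<lambda>n. indicator (A n) x) sums (indicator (\<Union>n. A n) x :: real)" for x
      using d by (intro indicator_sums) (auto simp: disjoint_family_on_def)
    then have "(\<lambda>n. c * (indicator (A n) a - indicator (A n) b)) sums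
        (c * (indicator (\<Union>n. A n) a - indicator (\<Union>n. A n) b))"
      by (intro sums_mult sums_diff)
    moreover have "A n \<in> sets borel" for n
      using A by auto
    moreover have "(\<Union>n. A n) \<in> sets borel"
      using A by auto
    ultimately show ?thesis
      by (simp add: dipole_def)
  qed
  then show ?thesis
    by (auto simp: finite_signed_measures_def dipole_def)
qed

lemma zero_finite_signed: "(\<lambda>_. 0) \<in> finite_signed_measures M"
  by (simp add: finite_signed_measures_def)

lemma signed_integral_zero: "signed_integral M (\<lambda>_. 0) f = 0"
  by (simp add: signed_integral_def negative_variation_def)

text \<open>A measurable subset of \<open>A\<close> has value at most \<open>c\<close> times the
  indicator of \<open>A\<close> at \<open>a\<close>. If \<open>a\<close> lies in \<open>A\<close>,
  the bound is attained at \<open>{a}\<close>, which is closed in a T1 space and misses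
  \<open>b\<close>.\<close>

lemma positive_variation_dipole:
  fixes a b :: "'a::t1_space"
  assumes c: "0 \<le> c" and ab: "a \<noteq> b"
  shows "positive_variation borel (dipole c a b) = density (return borel a) (\<lambda>_. ennreal c)"
    (is "_ = ?D")
proof -
  have "(SUP B\<in>{B \<in> sets borel. B \<subseteq> A}. ennreal (dipole c a b B)) = emeasure ?D A"
    if A: "A \<in> sets borel" for A
  proof -
    have "emeasure ?D A = ennreal c * indicator A a"
      using A by (simp add: emeasure_density_const)
    moreover have "(SUP B\<in>{B \<in> sets borel. B \<subseteq> A}. ennreal (dipole c a b B)) = ennreal c * indicator A a"
    proof (rule antisym)
      show "(SUP B\<in>{B \<in> sets borel. B \<subseteq> A}. ennreal (dipole c a b B)) \<le> ennreal c * indicator A a"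
        \<comment> \<open>A set containing \<open>b\<close> but not \<open>a\<close> has value
          \<open>- c\<close>, which \<open>ennreal\<close> sends to 0.\<close>
        using c by (intro SUP_least)
          (auto simp: dipole_def indicator_def ennreal_neg)
      show "ennreal c * indicator A a \<le> (SUP B\<in>{B \<in> sets borel. B \<subseteq> A}. ennreal (dipole c a b B))"
      proof (cases "a \<in> A")
        case True
        then have "ennreal (dipole c a b {a}) \<le> (SUP B\<in>{B \<in> sets borel. B \<subseteq> A}. ennreal (dipole c a b B))"
          by (intro SUP_upper) auto
        then show ?thesis
          using True ab by (simp add: dipole_def)
      qed simp
    qed
    ultimately show ?thesis
      by simp
  qed
  then have "positive_variation borel (dipole c a b) = measure_of (space borel) (sets borel) (emeasure ?D)"
    unfolding positive_variation_def
    by (intro measure_of_eq) (simp_all only: sets.space_closed sets.sigma_sets_eq)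
  also have "\<dots> = ?D"
    using measure_of_of_measure[of ?D] by simp
  finally show ?thesis .
qed

text \<open>Negating a dipole swaps its two points, so both variations are multiples of point
  masses.\<close>

lemma signed_integral_dipole:
  fixes a b :: "'a::t1_space"
  assumes "0 \<le> c" and "a \<noteq> b" and [measurable]: "f \<in> borel_measurable borel"
  shows "signed_integral borel (dipole c a b) f = c * (f a - f b)"
proof -
  have "(\<lambda>A. - dipole c a b A) = dipole c b a"
    by (auto simp: dipole_def algebra_simps)
  then show ?thesis
    using assms
    by (simp add: signed_integral_def negative_variation_def positive_variation_dipole
        integral_density integral_return right_diff_distrib)
qed

text \<open>The geometric majorant gives continuity of the series through the Weierstrass M-test;
  since all terms are nonnegative, the single term with index \<open>k\<close> gives the lower bound
  at \<open>x k\<close>.\<close>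

lemma continuous_dominating_function:
  fixes x :: "nat \<Rightarrow> real"
  assumes x: "\<And>k. 0 < x k" "\<And>k. x k \<le> 1"
  obtains f :: "real \<Rightarrow> real" where "continuous_on UNIV f" "\<And>t. 2 < \<bar>t\<bar> \<Longrightarrow> f t = 0"
    "f 0 = 0" "\<And>k. (1/2) ^ k \<le> f (x k)"
proof -
  define g where "g j t = (1/2) ^ j * min 1 (\<bar>t\<bar> / x j)" for j t
  have g0: "0 \<le> g j t" and g1: "g j t \<le> (1/2) ^ j" for j t
    using x(1)[of j] by (auto simp: g_def mult_left_le)
  have sm: "summable (\<lambda>j. (1/2::real) ^ j)"
    by (simp add: summable_geometric)
  have sg: "summable (\<lambda>j. g j t)" for t
    using g0 g1 by (intro summable_comparison_test'[OF sm, of 0]) auto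
  have "uniform_limit UNIV (\<lambda>n t. \<Sum>j<n. g j t) (\<lambda>t. \<Sum>j. g j t) sequentially"
    using g0 g1 by (intro Weierstrass_m_test[OF _ sm]) auto
  moreover have "continuous_on UNIV (\<lambda>t. \<Sum>j<n. g j t)" for n
    unfolding g_def by (intro continuous_intros) (metis less_irrefl x(1))
  ultimately have cont: "continuous_on UNIV (\<lambda>t. \<Sum>j. g j t)"
    by (intro uniform_limit_theorem[OF always_eventually]) auto
  \<comment> \<open>The cut-off factor is at least 1 on [-1, 1], where all \<open>x k\<close> lie,
    so it preserves the lower bounds.\<close>
  define f where "f t = max 0 (2 - \<bar>t\<bar>) * (\<Sum>j. g j t)" for t
  show thesis
  proof
    show "continuous_on UNIV f"
      unfolding f_def by (intro continuous_intros cont)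
    show "f t = 0" if "2 < \<bar>t\<bar>" for t
      using that by (simp add: f_def)
    show "f 0 = 0"
      by (simp add: f_def g_def)
    show "(1/2) ^ k \<le> f (x k)" for k
    proof -
      have "(1/2) ^ k = g k (x k)"
        using x(1)[of k] by (simp add: g_def)
      also have "\<dots> \<le> (\<Sum>j. g j (x k))"
        using sum_le_suminf[OF sg, of "{k}"] g0 by simp
      also have "\<dots> \<le> f (x k)"
        using x[of k] suminf_nonneg[OF sg, of "x k"] g0
        by (auto simp: f_def mult_le_cancel_right1)
      finally show ?thesis .
    qed
  qed
qed

text \<open>This treats both modes of convergence at once: \<open>dipoles\<close> feeds the diagonal
  choice, and \<open>vague\<close> allows testing the diagonal sequence against a compactly
  supported function.\<close>

lemma not_metrizes_convergence:
  assumes dipoles: "\<And>c a. 0 \<le> c \<Longrightarrow> (\<And>n. a n \<noteq> 0) \<Longrightarrow> a \<longlonglongrightarrow> 0 \<Longrightarrow> conv (\<lambda>n. dipole c (a n) 0) (\<lambda>_. 0)"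
    and vague: "\<And>\<mu>s \<mu>. conv \<mu>s \<mu> \<Longrightarrow> vaguely_converges \<mu>s \<mu>"
  shows "\<not> metrizes_convergence (finite_signed_measures (borel :: real measure)) conv d"
proof
  assume m: "metrizes_convergence (finite_signed_measures (borel :: real measure)) conv d"
  then interpret Metric_space "finite_signed_measures (borel :: real measure)" d
    by (simp add: metrizes_convergence_def)
  have iff: "(\<lambda>n. d (\<mu>s n) (\<lambda>_. 0)) \<longlonglongrightarrow> 0 \<longleftrightarrow> conv \<mu>s (\<lambda>_. 0)"
    if "\<And>n. \<mu>s n \<in> finite_signed_measures borel" for \<mu>s
    using m that zero_finite_signed unfolding metrizes_convergence_def by blast
  \<comment> \<open>The sequence \<open>a\<close> serves twice: as the positions of the dipoles and
    as the tolerances for their distances to 0.\<close>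
  define a where "a n = inverse (real (Suc n))" for n
  have a: "0 < a n" "a n \<le> 1" for n
    by (auto simp: a_def inverse_le_1_iff)
  have a_lim: "a \<longlonglongrightarrow> 0"
    unfolding a_def by (rule LIMSEQ_inverse_real_of_nat)
  have "\<exists>n. d (dipole (2 ^ k) (a n) 0) (\<lambda>_. 0) < a k" for k
  proof -
    have "conv (\<lambda>n. dipole (2 ^ k) (a n) 0) (\<lambda>_. 0)"
      using a(1) a_lim by (intro dipoles) (auto simp: less_le)
    then have "(\<lambda>n. d (dipole (2 ^ k) (a n) 0) (\<lambda>_. 0)) \<longlonglongrightarrow> 0"
      by (simp add: iff dipole_finite_signed)
    then have "\<forall>\<^sub>F n in sequentially. d (dipole (2 ^ k) (a n) 0) (\<lambda>_. 0) < a k"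
      using a(1) by (rule order_tendstoD)
    then show ?thesis
      by (rule eventually_happens'[OF sequentially_bot])
  qed
  then obtain n where n: "d (dipole (2 ^ k) (a (n k)) 0) (\<lambda>_. 0) < a k" for k
    by metis
  define \<nu> where "\<nu> k = dipole (2 ^ k) (a (n k)) 0" for k
  \<comment> \<open>The lower bound for the sandwich is the nonnegativity of
    \<open>d\<close>.\<close>
  have "(\<lambda>k. d (\<nu> k) (\<lambda>_. 0)) \<longlonglongrightarrow> 0"
    using n by (intro tendsto_sandwich[OF _ _ tendsto_const a_lim])
      (auto simp: \<nu>_def less_imp_le intro!: always_eventually)
  then have v: "vaguely_converges \<nu> (\<lambda>_. 0)"
    by (intro vague iff[THEN iffD1]) (simp_all add: \<nu>_def dipole_finite_signed)
  obtain f :: "real \<Rightarrow> real" where f: "continuous_on UNIV f" "\<And>t. 2 < \<bar>t\<bar> \<Longrightarrow> f t = 0"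
    "f 0 = 0" "\<And>k. (1/2) ^ k \<le> f (a (n k))"
    using continuous_dominating_function[of "\<lambda>k. a (n k)", OF a] by blast
  have "{t. f t \<noteq> 0} \<subseteq> cball 0 2"
    using f(2) by (auto simp: not_less[symmetric])
  then have "compact (closure {t. f t \<noteq> 0})"
    using bounded_subset[OF bounded_cball] by (simp add: compact_closure)
  with v f(1) have lim: "(\<lambda>k. signed_integral borel (\<nu> k) f) \<longlonglongrightarrow> 0"
    by (simp add: vaguely_converges_def signed_integral_zero)
  \<comment> \<open>The weight \<open>2 ^ k\<close> cancels the lower bound
    \<open>(1/2) ^ k\<close>, and \<open>f 0 = 0\<close> removes the mass at the origin.\<close>
  have "1 \<le> signed_integral borel (\<nu> k) f" for k
  proof -
    have "1 = 2 ^ k * (1/2::real) ^ k"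
      by (simp add: power_one_over)
    also have "\<dots> \<le> 2 ^ k * f (a (n k))"
      using f(4) by (intro mult_left_mono) auto
    also have "\<dots> = signed_integral borel (\<nu> k) f"
      using f(1,3) a(1)[of "n k"]
      by (simp add: \<nu>_def signed_integral_dipole borel_measurable_continuous_onI)
    finally show ?thesis .
  qed
  then have "(1::real) \<le> 0"
    by (intro LIMSEQ_le_const[OF lim]) auto
  then show False
    by simp
qed

lemma tendsto_signed_integral_dipole:
  fixes f :: "'a::t1_space \<Rightarrow> real"
  assumes "continuous_on UNIV f" "0 \<le> c" "\<And>n. a n \<noteq> b" "a \<longlonglongrightarrow> b"
  shows "(\<lambda>n. signed_integral borel (dipole c (a n) b) f) \<longlonglongrightarrow> 0"
proof -
  have "(\<lambda>n. f (a n)) \<longlonglongrightarrow> f b"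
    using assms(1,4) by (rule continuous_on_tendsto_compose) auto
  then have "(\<lambda>n. c * (f (a n) - f b)) \<longlonglongrightarrow> c * (f b - f b)"
    by (intro tendsto_intros)
  then show ?thesis
    using assms by (simp add: signed_integral_dipole borel_measurable_continuous_onI)
qed

text \<open>A function with compact support is zero near infinity, so it is also a test function for
  loose convergence.\<close>

lemma loosely_converges_imp_vaguely_converges:
  assumes "loosely_converges \<mu>s \<mu>"
  shows "vaguely_converges \<mu>s \<mu>"
  unfolding vaguely_converges_def
proof (intro allI impI)
  fix f :: "real \<Rightarrow> real"
  assume f: "continuous_on UNIV f" "compact (closure {x. f x \<noteq> 0})"
  then have "bounded {x. f x \<noteq> 0}"
    using compact_imp_bounded bounded_subset closure_subset by blast
  then obtain B where "\<And>x. f x \<noteq> 0 \<Longrightarrow> norm x \<le> B"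
    by (auto simp: bounded_iff)
  \<comment> \<open>The bound \<open>B\<close> may be attained on the support; from
    \<open>B + 1\<close> on, the norm exceeds it strictly.\<close>
  then have "\<forall>\<^sub>F x in at_infinity. f x = 0"
    unfolding eventually_at_infinity by (intro exI[of _ "B + 1"]) force
  then have "(f \<longlongrightarrow> 0) at_infinity"
    by (rule tendsto_eventually)
  with f(1) assms show "(\<lambda>n. signed_integral borel (\<mu>s n) f) \<longlonglongrightarrow> signed_integral borel \<mu> f"
    by (simp add: loosely_converges_def)
qed

theorem corollary3p20:
  "(\<nexists>d. metrizes_convergence (finite_signed_measures (borel :: real measure)) vaguely_converges d) \<and>
   (\<nexists>d. metrizes_convergence (finite_signed_measures (borel :: real measure)) loosely_converges d)"
proof -
  have loose: "loosely_converges (\<lambda>n. dipole c (a n) 0) (\<lambda>_. 0)"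
    if "0 \<le> c" "\<And>n. a n \<noteq> 0" "a \<longlonglongrightarrow> 0" for c a
    using that by (simp add: loosely_converges_def signed_integral_zero tendsto_signed_integral_dipole)
  \<comment> \<open>Here the premise \<open>vague\<close> is trivial, and the dipoles converge
    vaguely because they converge loosely.\<close>
  have "\<not> metrizes_convergence (finite_signed_measures borel) vaguely_converges d" for d
    by (rule not_metrizes_convergence) (rule loosely_converges_imp_vaguely_converges[OF loose])
  moreover have "\<not> metrizes_convergence (finite_signed_measures borel) loosely_converges d" for d
    by (rule not_metrizes_convergence) (rule loose loosely_converges_imp_vaguely_converges; assumption)+
  ultimately show ?thesis
    by blast
qed

end
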